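(* The only perfect squares that are sums of two repdigits are $11^2$, $12^2$, $38^2$ and $211^2$, which arise as follows: \begin{align*} 11^2 &= 99+22 = 88+33 = 77+44 = 66+55,\\ 12^2 &= 111+33,\\ 38^2 &= 1111+333,\\ 211^2 &= 44444+77. \end{align*}
   Context: A repdigit is a natural number greater than $10$ all of whose base-10 digits are the same (so every repdigit has at least two digits; one-digit numbers are not repdigits). Equivalently, a repdigit is a number of the form $a\cdot\frac{10^m-1}{9}$ with $a\in\{1,\dots,9\}$ and $m\ge 2$. The two repdigits in a sum are allowed to be equal. *)

theory Defs
  imports Complex_Main "HOL-Computational_Algebra.Nth_Powers"
begin

(* The i-th base-10 digit of n is n div 10 ^ i mod 10; the condition 10 ^ i \<le> n picks out
   exactly the positions that occur in the decimal expansion (no leading zeros). *)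
definition repdigit :: "nat \<Rightarrow> bool" where
  "repdigit n \<longleftrightarrow> n > 10 \<and> (\<exists>d. \<forall>i. 10 ^ i \<le> n \<longrightarrow> n div 10 ^ i mod 10 = d)"

(* A representation as an unordered sum is recorded once, with the larger summand first;
   the summands may be equal. *)
definition repdigit_sums :: "nat \<Rightarrow> (nat \<times> nat) set" where
  "repdigit_sums s = {(x, y). repdigit x \<and> repdigit y \<and> y \<le> x \<and> s = x + y}"

end

theory Submission
  imports Defs
begin

text \<open>
Writing the summands as \<open>a * (10 ^ m - 1) / 9\<close> and \<open>b * (10 ^ n - 1) / 9\<close> with \<open>2 \<le> n \<le> m\<close>,
the equation becomes \<open>9 z\<^sup>2 + (a + b) = a * 10 ^ m + b * 10 ^ n\<close>. Since \<open>- (a + b)\<close> must be a square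
modulo 100, \<open>a + b\<close> is 4, 11 or 16, and then powers of 2 bound \<open>n\<close> by 3, 2 and 5, respectively.
This leaves 26 triples \<open>(a, b, n)\<close>. For \<open>m < 8\<close> they are decided modulo small primes; for \<open>m \<ge> 8\<close> all
but eight are impossible modulo 256. Of those eight,

\<^item> in three the constant term is a square \<open>e\<^sup>2\<close>, so that \<open>5 ^ m\<close> divides \<open>3 z + e\<close> or \<open>3 z - e\<close>,
  which is too large;

\<^item> in one, congruences on \<open>m\<close> modulo 8 and 30 suffice;

\<^item> the remaining four really have a solution with small \<open>m\<close>. For one parity of \<open>m\<close> they are
  excluded by congruences or by a difference of squares; for the other parity they are Pell
  equations \<open>C x\<^sup>2 - D y\<^sup>2 = K\<close> with \<open>y = y0 * 10 ^ k\<close>. All solutions of such an equation lie on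
  finitely many orbits of a unit, which are periodic modulo every number, and no orbit meets
  \<open>y \<equiv> 0\<close> modulo \<open>M\<close> (16 or 20) at the same time as \<open>y \<in> y0 * {10 ^ i}\<close> modulo a suitable prime \<open>p\<close>.
\<close>

subsection \<open>Pell orbits\<close>

text \<open>Multiplication of x sqrt C + y sqrt D by a unit u + t sqrt(CD), where v = t D and w = t
  C. The relations \<open>C * v = D * w\<close> and \<open>u * u = v * w + 1\<close>, assumed in
  \<open>pell_descent\<close>, make C x^2 - D y^2 invariant.\<close>

fun pell_step :: "int \<Rightarrow> int \<Rightarrow> int \<Rightarrow> int \<times> int \<Rightarrow> int \<times> int" where
  "pell_step u v w (x, y) = (u * x + v * y, w * x + u * y)"

fun pell_step_mod :: "int \<Rightarrow> int \<Rightarrow> int \<Rightarrow> int \<Rightarrow> int \<times> int \<Rightarrow> int \<times> int" where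
  "pell_step_mod N u v w (x, y) = ((u * x + v * y) mod N, (w * x + u * y) mod N)"

text \<open>Dividing by the unit lowers y as long as y is at least \<open>B\<close>, so every
  solution descends to a base point. The bound on \<open>w * w * K\<close> keeps the new y
  nonnegative.\<close>

lemma pell_descent:
  fixes C D K u v w B x y :: int
  assumes pos: "C > 0" "D > 0" "K > 0" "u \<ge> 1" "w > 0" "B \<ge> 0"
    and unit: "C * v = D * w" "u * u = v * w + 1"
    and B: "w * w * K \<le> C * (B * B)"
    and base: "\<And>x y. 0 \<le> x \<Longrightarrow> 0 \<le> y \<Longrightarrow> y < B \<Longrightarrow> C * (x * x) = D * (y * y) + K \<Longrightarrow> (x, y) \<in> S"
    and xy: "0 \<le> x" "0 \<le> y" "C * (x * x) = D * (y * y) + K"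
  shows "\<exists>s\<in>S. \<exists>j. (x, y) = (pell_step u v w ^^ j) s"
  using xy
proof (induction "nat y" arbitrary: x y rule: less_induct)
  case less
  show ?case
  proof (cases "y < B")
    case True
    then have "(x, y) = (pell_step u v w ^^ 0) (x, y) \<and> (x, y) \<in> S"
      using base less.prems by simp
    then show ?thesis by blast
  next
    case False
    define x' y' where "x' = u * x - v * y" and "y' = u * y - w * x"
    have v: "v \<ge> 0"
      using unit(1) pos by (metis less_le_not_le mult_pos_pos nle_le zero_less_mult_pos)
    have CK: "w * w * K \<le> C * (y * y)"
      using B False pos(1,6) mult_mono[of B y B y]
      by (smt (verit, best) mult_left_mono)
    have "C * ((u * y) * (u * y)) - C * ((w * x) * (w * x)) = C * (y * y) * (u * u) - w * w * (C * (x * x))"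
      by (simp add: algebra_simps)
    also have "\<dots> = C * (y * y) + (C * v) * w * (y * y) - w * w * (D * (y * y) + K)"
      unfolding unit(2) less.prems(3) by (simp add: algebra_simps)
    also have "\<dots> = C * (y * y) - w * w * K"
      unfolding unit(1) by (simp add: algebra_simps)
    finally have e1: "C * ((u * y) * (u * y)) - C * ((w * x) * (w * x)) = C * (y * y) - w * w * K" .
    then have "(w * x) * (w * x) \<le> (u * y) * (u * y)"
      using CK pos(1) by (smt (verit) mult_le_cancel_left_pos)
    then have y'0: "y' \<ge> 0"
      unfolding y'_def using less.prems pos
      by (smt (verit, ccfv_SIG) mult_mono mult_nonneg_nonneg mult_strict_mono)
    \<comment> \<open>Strict because w^2 K > 0; dropping the nonnegative cross term leaves (u - 1) y
      < w x, that is y' < y.\<close>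
    have "C * ((w * x) * (w * x)) = C * ((u * y) * (u * y)) - C * (y * y) + w * w * K"
      using e1 by simp
    also have "\<dots> > C * ((u * y) * (u * y)) - C * (y * y)" using pos by simp
    also have "C * ((u * y) * (u * y)) - C * (y * y) = C * (((u - 1) * y) * ((u - 1) * y)) + 2 * (C * (y * y) * (u - 1))"
      by (simp add: algebra_simps)
    finally have "C * (((u - 1) * y) * ((u - 1) * y)) + 2 * (C * (y * y) * (u - 1)) < C * ((w * x) * (w * x))" .
    moreover have "0 \<le> C * (y * y) * (u - 1)" using pos by simp
    ultimately have "C * (((u - 1) * y) * ((u - 1) * y)) < C * ((w * x) * (w * x))" by linarith
    then have "((u - 1) * y) * ((u - 1) * y) < (w * x) * (w * x)"
      using pos(1) by (simp add: mult_less_cancel_left_pos)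
    then have "(u - 1) * y < w * x"
      using less.prems pos by (smt (verit, ccfv_SIG) mult_mono mult_nonneg_nonneg)
    then have y'1: "y' < y" unfolding y'_def by (simp add: algebra_simps)
    have "D * ((u * x) * (u * x)) - D * ((v * y) * (v * y)) = D * (x * x) * (u * u) - v * v * (D * (y * y))"
      by (simp add: algebra_simps)
    also have "\<dots> = D * (x * x) + v * (D * w) * (x * x) - v * v * (D * (y * y))"
      unfolding unit(2) by (simp add: algebra_simps)
    also have "\<dots> = D * (x * x) + v * v * (C * (x * x)) - v * v * (D * (y * y))"
      unfolding unit(1)[symmetric] by (simp add: algebra_simps)
    also have "\<dots> = D * (x * x) + v * v * K"
      unfolding less.prems(3) by (simp add: algebra_simps)
    also have "\<dots> \<ge> 0" using pos by simp
    finally have "(v * y) * (v * y) \<le> (u * x) * (u * x)"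
      using pos(2) by (smt (verit) mult_le_cancel_left_pos)
    then have x'0: "x' \<ge> 0"
      unfolding x'_def using less.prems pos v
      by (smt (verit, ccfv_SIG) mult_mono mult_nonneg_nonneg mult_strict_mono)
    have "C * (x' * x') - D * (y' * y') = C * (x * x) * (u * u) - (2 * u * x * y) * (C * v) + (C * v) * v * (y * y)
        - D * (y * y) * (u * u) + (2 * u * x * y) * (D * w) - (D * w) * w * (x * x)"
      unfolding x'_def y'_def by (simp add: algebra_simps)
    also have "\<dots> = (C * (x * x) - D * (y * y)) * (u * u) + (D * w) * v * (y * y) - (C * v) * w * (x * x)"
      unfolding unit(1) by (simp add: algebra_simps)
    also have "\<dots> = C * (x * x) - D * (y * y)"
      unfolding unit(2) by (simp add: algebra_simps)
    finally have eq': "C * (x' * x') = D * (y' * y') + K" using less.prems(3) by simp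
    have "u * x' + v * y' = (u * u) * x - v * w * x" "w * x' + u * y' = (u * u) * y - v * w * y"
      unfolding x'_def y'_def by (simp_all add: algebra_simps)
    then have step: "pell_step u v w (x', y') = (x, y)"
      unfolding unit(2) by (simp add: algebra_simps)
    obtain s j where "s \<in> S" "(x', y') = (pell_step u v w ^^ j) s"
      using less.hyps[OF _ x'0 y'0 eq'] y'0 y'1 by auto
    then have "(x, y) = (pell_step u v w ^^ Suc j) s" using step by simp
    then show ?thesis using \<open>s \<in> S\<close> by blast
  qed
qed

lemma pell_step_mod:
  "map_prod (\<lambda>t. t mod N) (\<lambda>t. t mod N) (pell_step u v w p)
    = pell_step_mod N u v w (map_prod (\<lambda>t. t mod N) (\<lambda>t. t mod N) p)"
proof (cases p)
  case (Pair x y)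
  have "(p * x + q * y) mod N = (p * (x mod N) + q * (y mod N)) mod N" for p q :: int
    by (intro mod_add_cong) (simp_all add: mod_mult_right_eq)
  then show ?thesis using Pair by simp
qed

text \<open>The scan advances \<open>y\<close> through \<open>{0..<B}\<close> while \<open>x\<close> stays the least number with
  \<open>D y\<^sup>2 + K \<le> C x\<^sup>2\<close>; the natural number is fuel.\<close>

fun base_points :: "int \<Rightarrow> int \<Rightarrow> int \<Rightarrow> int \<Rightarrow> (int \<times> int) list \<Rightarrow> nat \<Rightarrow> int \<Rightarrow> int \<Rightarrow> bool" where
  "base_points C D K B S 0 x y \<longleftrightarrow> B \<le> y"
| "base_points C D K B S (Suc n) x y \<longleftrightarrow>
    (if C * (x * x) < D * (y * y) + K then base_points C D K B S n (x + 1) y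
     else if C * (x * x) = D * (y * y) + K then List.member S (x, y) \<and> base_points C D K B S n x (y + 1)
     else base_points C D K B S n x (y + 1))"

text \<open>The hypothesis on \<open>t\<close> is the scan invariant: nothing below \<open>x\<close>
  can pair with the current or a later y. Both moves preserve it, so no solution is skipped.\<close>

lemma base_pointsD:
  assumes "base_points C D K B S n x y" "C > 0" "D \<ge> 0" "0 \<le> x" "0 \<le> y"
    and "\<And>t. 0 \<le> t \<Longrightarrow> t < x \<Longrightarrow> C * (t * t) < D * (y * y) + K"
    and "C * (x' * x') = D * (y' * y') + K" "0 \<le> x'" "y \<le> y'" "y' < B"
  shows "(x', y') \<in> set S"
  using assms
proof (induction C D K B S n x y rule: base_points.induct)
  case (2 C D K B S n x y)
  have mono: "D * (y * y) \<le> D * ((y + 1) * (y + 1))"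
    using 2 by (intro mult_left_mono mult_mono) auto
  show ?case
  proof (cases "C * (x * x) < D * (y * y) + K")
    case True
    moreover have "C * (t * t) < D * (y * y) + K" if "0 \<le> t" "t < x + 1" for t
      using 2(9)[of t] that True by (cases "t = x") auto
    ultimately show ?thesis using 2 by simp
  next
    case False
    have less: "C * (t * t) < D * ((y + 1) * (y + 1)) + K" if "0 \<le> t" "t < x" for t
      using 2(9)[of t] that mono by linarith
    show ?thesis
    proof (cases "y' = y")
      case True
      have "\<not> x' < x" using 2(9)[of x'] 2(10,11) True by auto
      moreover have "\<not> x < x'"
      proof
        assume "x < x'"
        then have "x * x < x' * x'" using 2(7) by (simp add: mult_strict_mono)
        then show False using 2(5,10) True False by (smt (verit) mult_less_cancel_left_pos)
      qed
      ultimately have "x' = x" by simp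
      then show ?thesis using 2(4,10) True by simp
    next
      case y': False
      show ?thesis
      proof (cases "C * (x * x) = D * (y * y) + K")
        case True
        then show ?thesis using 2(2)[OF False True] 2(4-) y' less False by auto
      next
        case neq: False
        then show ?thesis using 2(3)[OF False neq] 2(4-) y' less False by auto
      qed
    qed
  qed
qed simp

text \<open>Applied with \<open>t\<close> equal to \<open>s\<close>: the check then also certifies
  that \<open>n\<close> is a period, so finitely many steps settle every iterate.\<close>

fun orbit_avoids :: "('a \<Rightarrow> 'a) \<Rightarrow> ('a \<Rightarrow> bool) \<Rightarrow> nat \<Rightarrow> 'a \<Rightarrow> 'a \<Rightarrow> bool" where
  "orbit_avoids f bad 0 s t \<longleftrightarrow> s = t"
| "orbit_avoids f bad (Suc n) s t \<longleftrightarrow> \<not> bad s \<and> orbit_avoids f bad n (f s) t"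

lemma orbit_avoidsD:
  assumes "orbit_avoids f bad n s t"
  shows "(f ^^ n) s = t" "j < n \<Longrightarrow> \<not> bad ((f ^^ j) s)"
  using assms
proof (induction f bad n s t arbitrary: j rule: orbit_avoids.induct)
  case (2 f bad n s t)
  { case 1 then show ?case using 2 by (simp add: funpow_swap1) }
  { case 2 then show ?case using "2.IH" by (cases j) (simp_all add: funpow_swap1) }
qed simp_all

text \<open>The conditional, unlike a conjunction, is evaluated lazily by the simplifier.\<close>

fun hits :: "int \<Rightarrow> int \<Rightarrow> int list \<Rightarrow> int \<times> int \<Rightarrow> bool" where
  "hits M p P (x, y) \<longleftrightarrow> (if y mod M = 0 then List.member P (y mod p) else False)"

text \<open>The modulus \<open>M * p\<close> remembers y modulo both \<open>M\<close> and
  \<open>p\<close>. By \<open>pell_descent\<close> it is enough to follow each base point through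
  one period \<open>L\<close>.\<close>

lemma pell_sieve:
  fixes C D K u v w B x y M p :: int
  assumes "C > 0" "D > 0" "K > 0" "u \<ge> 1" "w > 0" "B \<ge> 0"
    and "C * v = D * w" "u * u = v * w + 1"
    and "w * w * K \<le> C * (B * B)"
    and base: "base_points C D K B S n 0 0"
    and xy: "0 \<le> x" "0 \<le> y" "C * (x * x) = D * (y * y) + K"
    and L: "L > 0"
    and orbits: "list_all (\<lambda>(x, y). orbit_avoids (pell_step_mod (M * p) u v w) (hits M p P) L
          (x mod (M * p), y mod (M * p)) (x mod (M * p), y mod (M * p))) S"
    and "M dvd y"
  shows "y mod p \<notin> set P"
proof -
  let ?N = "M * p"
  let ?r = "map_prod (\<lambda>t. t mod ?N) (\<lambda>t. t mod ?N)"
  let ?f = "pell_step_mod ?N u v w"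
  have "(x, y) \<in> set S" if "0 \<le> x" "0 \<le> y" "y < B" "C * (x * x) = D * (y * y) + K" for x y
    using base_pointsD[OF base, of x y] that assms(1,2) by auto
  then obtain s j where s: "s \<in> set S" and j: "(x, y) = (pell_step u v w ^^ j) s"
    using pell_descent[of C D K u w B v "set S" x y] assms(1-9) xy by blast
  have avoid: "orbit_avoids ?f (hits M p P) L (?r s) (?r s)"
    using orbits s by (auto simp: list_all_iff case_prod_beta map_prod_def)
  have "?r ((pell_step u v w ^^ j) s) = (?f ^^ j) (?r s)"
    by (induction j) (simp_all add: pell_step_mod)
  then have "(x mod ?N, y mod ?N) = (?f ^^ j) (?r s)"
    unfolding j[symmetric] by simp
  also have "\<dots> = (?f ^^ (j mod L)) (?r s)"
    using orbit_avoidsD(1)[OF avoid] by (rule funpow_mod_eq[symmetric])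
  finally have "(x mod ?N, y mod ?N) = (?f ^^ (j mod L)) (?r s)" .
  then have "\<not> hits M p P (x mod ?N, y mod ?N)"
    using orbit_avoidsD(2)[OF avoid, of "j mod L"] L by simp
  then show ?thesis
    using \<open>M dvd y\<close> by (auto simp: mod_mod_cancel)
qed

section \<open>Powers of 10 and the four Pell equations\<close>

lemma power_mod_period:
  fixes q :: int
  assumes "10 ^ p mod q = 1"
  shows "10 ^ m mod q = 10 ^ (m mod p) mod q"
proof -
  have "(10 ^ m :: int) = (10 ^ p) ^ (m div p) * 10 ^ (m mod p)"
    by (metis div_mult_mod_eq mult.commute power_add power_mult)
  also have "\<dots> mod q = ((10 ^ p mod q) ^ (m div p) * 10 ^ (m mod p)) mod q"
    by (metis mod_mult_left_eq power_mod)
  finally show ?thesis using assms by simp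
qed

lemma power_residue_mem:
  assumes "10 ^ p mod q = (1 :: int)" "p > 0"
  shows "y0 * 10 ^ k mod q \<in> set (map (\<lambda>i. y0 * 10 ^ i mod q) [0..<p])"
proof -
  have "y0 * 10 ^ k mod q = y0 * 10 ^ (k mod p) mod q"
    by (metis power_mod_period[OF assms(1)] mod_mult_right_eq)
  then show ?thesis using assms(2) by (auto simp: image_iff intro!: bexI[of _ "k mod p"])
qed

lemma dvd_ten_power:
  assumes "(M :: int) dvd 10 ^ j" "j \<le> k"
  shows "M dvd y0 * 10 ^ k"
  using assms by (meson dvd_mult dvd_trans le_imp_power_dvd)

text \<open>The unit is 19 + 6 sqrt 10, and 158 is the least \<open>B\<close> that
  \<open>pell_descent\<close> allows. The true solution y = 200, from 211^2, lies on an orbit, so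
  \<open>M\<close> must not divide 200. Since 641 divides 10^16 + 1, powers of 10 take only 32
  residues.\<close>

lemma pell_689:
  assumes "0 \<le> x" "k \<ge> 4"
  shows "x * x \<noteq> 10 * ((2 * 10 ^ k) * (2 * 10 ^ k)) + (689 :: int)"
proof
  assume eq: "x * x = 10 * ((2 * 10 ^ k) * (2 * 10 ^ k)) + (689 :: int)"
  let ?S = "[(27, 2), (57, 16), (393, 124), (123, 38)]"
  let ?P = "map (\<lambda>i. 2 * 10 ^ i mod 641) [0..<32] :: int list"
  have base: "base_points 1 10 689 158 ?S 660 0 0" by code_simp
  have orbits: "list_all (\<lambda>(x, y). orbit_avoids (pell_step_mod (16 * 641) 19 60 6) (hits 16 641 ?P) 160
      (x mod (16 * 641), y mod (16 * 641)) (x mod (16 * 641), y mod (16 * 641))) ?S"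
    by code_simp
  have "2 * 10 ^ k mod 641 \<notin> set ?P"
    by (rule pell_sieve[OF _ _ _ _ _ _ _ _ _ base assms(1) _ _ _ orbits])
       (use eq assms(2) in \<open>simp_all add: dvd_ten_power[of _ 4]\<close>)
  then show False using power_residue_mem[of 32 641 2 k] by simp
qed

text \<open>The unit is 5 + 2 sqrt 6. The true solution (11, 10), from 66 + 55, forbids
  \<open>M\<close> = 10. No orbit meets y = 0 modulo 20, so the trivial modulus 1 serves as
  \<open>p\<close>.\<close>

lemma pell_163:
  assumes "0 \<le> x" "k \<ge> 4"
  shows "3 * (x * x) \<noteq> 2 * (10 ^ k * 10 ^ k) + (163 :: int)"
proof
  assume eq: "3 * (x * x) = 2 * (10 ^ k * 10 ^ k) + (163 :: int)"
  let ?S = "[(11, 10), (15, 16)]"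
  have base: "base_points 3 2 163 45 ?S 90 0 0" by code_simp
  have orbits: "list_all (\<lambda>(x, y). orbit_avoids (pell_step_mod (20 * 1) 5 4 6) (hits 20 1 [0]) 4
      (x mod (20 * 1), y mod (20 * 1)) (x mod (20 * 1), y mod (20 * 1))) ?S"
    by code_simp
  have "10 ^ k mod 1 \<notin> set [0 :: int]"
    by (rule pell_sieve[OF _ _ _ _ _ _ _ _ _ base assms(1) _ _ _ orbits])
       (use eq assms(2) dvd_ten_power[of 20 4 k 1] in simp_all)
  then show False by simp
qed

text \<open>The unit is 3 + 2 sqrt 2; the true solution to avoid is (33, 10), from 22 + 99.\<close>

lemma pell_889:
  assumes "0 \<le> x" "k \<ge> 4"
  shows "x * x \<noteq> 2 * (10 ^ k * 10 ^ k) + (889 :: int)"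
proof
  assume eq: "x * x = 2 * (10 ^ k * 10 ^ k) + (889 :: int)"
  let ?S = "[(31, 6), (33, 10), (59, 36), (69, 44)]"
  let ?P = "map (\<lambda>i. 1 * 10 ^ i mod 11) [0..<2] :: int list"
  have base: "base_points 1 2 889 60 ?S 152 0 0" by code_simp
  have orbits: "list_all (\<lambda>(x, y). orbit_avoids (pell_step_mod (20 * 11) 3 4 2) (hits 20 11 ?P) 12
      (x mod (20 * 11), y mod (20 * 11)) (x mod (20 * 11), y mod (20 * 11))) ?S"
    by code_simp
  have "10 ^ k mod 11 \<notin> set ?P"
    by (rule pell_sieve[OF _ _ _ _ _ _ _ _ _ base assms(1) _ _ _ orbits])
       (use eq assms(2) dvd_ten_power[of 20 4 k 1] in simp_all)
  then show False using power_residue_mem[of 2 11 1 k] by simp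
qed

text \<open>The unit is 2 + sqrt 3; the true solution to avoid is (12, 10), from 33 + 111.\<close>

lemma pell_332:
  assumes "0 \<le> x" "k \<ge> 4"
  shows "3 * (x * x) \<noteq> 10 ^ k * 10 ^ k + (332 :: int)"
proof
  assume eq: "3 * (x * x) = 10 ^ k * 10 ^ k + (332 :: int)"
  let ?S = "[(12, 10), (14, 16)]"
  let ?P = "map (\<lambda>i. 1 * 10 ^ i mod 13) [0..<6] :: int list"
  have base: "base_points 3 1 332 32 ?S 60 0 0" by code_simp
  have orbits: "list_all (\<lambda>(x, y). orbit_avoids (pell_step_mod (20 * 13) 2 1 3) (hits 20 13 ?P) 12
      (x mod (20 * 13), y mod (20 * 13)) (x mod (20 * 13), y mod (20 * 13))) ?S"
    by code_simp
  have "10 ^ k mod 13 \<notin> set ?P"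
    by (rule pell_sieve[OF _ _ _ _ _ _ _ _ _ base assms(1) _ _ _ orbits])
       (use eq assms(2) dvd_ten_power[of 20 4 k 1] in simp_all)
  then show False using power_residue_mem[of 6 13 1 k] by simp
qed

subsection \<open>Congruence obstructions\<close>

text \<open>An evaluable certificate of insolubility. The factor 9 comes from clearing the
  denominator of (10^m - 1)/9.\<close>

definition obstructed :: "int \<Rightarrow> int \<Rightarrow> bool" where
  "obstructed q t \<longleftrightarrow> q > 0 \<and> list_all (\<lambda>z. 9 * (z * z) mod q \<noteq> t mod q) [0..q - 1]"

lemma obstructedD:
  assumes "obstructed q t'" "q dvd t - t'"
  shows "9 * (z * z) \<noteq> t"
proof
  assume "9 * (z * z) = t"
  moreover have "9 * ((z mod q) * (z mod q)) mod q = 9 * (z * z) mod q"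
    by (metis mod_mult_eq mod_mult_right_eq)
  moreover have "z mod q \<in> set [0..q - 1]"
    using assms(1) by (simp add: obstructed_def)
  moreover have "t mod q = t' mod q"
    using assms(2) by (simp add: mod_eq_dvd_iff)
  ultimately show False
    using assms(1) unfolding obstructed_def list_all_iff by metis
qed

text \<open>A covering system: 10^m modulo \<open>q\<close> depends only on m modulo
  \<open>p\<close>, and each class in \<open>R\<close> is excluded by some modulus in
  \<open>Q\<close>.\<close>

lemma obstructed_covering:
  fixes a K z :: int and m P :: nat
  assumes "list_all (\<lambda>(q, p). 10 ^ p mod q = 1 \<and> p dvd P) Q"
    and "list_all (\<lambda>r. list_ex (\<lambda>(q, p). obstructed q (a * 10 ^ (r mod p) + K)) Q) R"
    and "m mod P \<in> set R"
  shows "9 * (z * z) \<noteq> a * 10 ^ m + K"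
proof -
  obtain q p where qp: "10 ^ p mod q = (1 :: int)" "p dvd P" "obstructed q (a * 10 ^ (m mod P mod p) + K)"
    using assms by (fastforce simp: list_all_iff list_ex_iff)
  have "(a * 10 ^ m + K) mod q = (a * 10 ^ (m mod p) + K) mod q"
    by (metis power_mod_period[OF qp(1)] mod_add_left_eq mod_mult_right_eq)
  then have "q dvd (a * 10 ^ m + K) - (a * 10 ^ (m mod P mod p) + K)"
    using qp(2) by (simp add: mod_mod_cancel mod_eq_dvd_iff)
  then show ?thesis using obstructedD[OF qp(3)] by blast
qed

text \<open>In (X - e)(X + e) = A 10^m only one factor can be divisible by 5, as 5 does not divide
  2e. Hence 5^m is at most X + e, which has order only 10^(m/2).\<close>

lemma difference_of_squares_bound:
  fixes A e X :: int
  assumes "X * X = A * 10 ^ m + e * e" "0 < A" "A \<le> 8" "0 < e" "e \<le> 28" "\<not> 5 dvd 2 * e" "0 \<le> X"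
  shows "m < 4"
proof (rule ccontr)
  assume m: "\<not> m < 4"
  have "e * e < X * X" using assms(1,2) by simp
  then have "e < X" using assms(7) by (smt (verit) mult_mono)
  have prod: "(X - e) * (X + e) = A * 2 ^ m * 5 ^ m"
    using assms(1) power_mult_distrib[of 2 "5 :: int" m] by (simp add: algebra_simps)
  have "5 ^ m dvd (X - e) * (X + e)" unfolding prod by simp
  moreover have "\<not> 5 dvd X - e \<or> \<not> 5 dvd X + e"
    using assms(6) dvd_diff[of 5 "X + e" "X - e"] by auto
  moreover have "coprime (5 ^ m) t" if "\<not> 5 dvd t" for t :: int
    using that prime_imp_coprime[of "5 :: int" t] by simp
  ultimately have "5 ^ m dvd X + e \<or> 5 ^ m dvd X - e"
    by (metis coprime_dvd_mult_left_iff coprime_dvd_mult_right_iff)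
  then have "5 ^ m \<le> X + e"
    using \<open>e < X\<close> assms(4) by (auto dest!: zdvd_imp_le)
  then have "5 ^ m * 5 ^ m \<le> (X + e) * (X + e)"
    using assms(4,7) by (intro mult_mono) auto
  also have "\<dots> \<le> 2 * (X * X) + 2 * (e * e)"
    using zero_le_square[of "X - e"] by (simp add: algebra_simps)
  also have "\<dots> = 2 * A * 10 ^ m + 4 * (e * e)" unfolding assms(1) by simp
  also have "\<dots> \<le> 16 * 10 ^ m + 4 * (28 * 28)"
    using assms(3-5) by (intro add_mono mult_mono) auto
  also have "\<dots> < 17 * 10 ^ m"
    using power_increasing[of 4 m "10 :: int"] m by simp
  \<comment> \<open>This is where the bound 4 arises: 2.5^3 < 17 < 2.5^4.\<close>
  also have "17 * 10 ^ m < (25 :: int) ^ m"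
    using m[unfolded not_less]
  proof (induction m rule: nat_induct_at_least)
    case (Suc n)
    moreover have "0 < (25 :: int) ^ n" by simp
    ultimately show ?case unfolding power_Suc by linarith
  qed simp
  also have "(25 :: int) ^ m = 5 ^ m * 5 ^ m"
    by (simp flip: power_mult_distrib)
  finally show False by simp
qed

subsection \<open>The exponential equation\<close>

text \<open>The constants are \<open>b * 10 ^ n - (a + b)\<close> for the eight triples that survive
  modulo 256. In the Pell cases m is 2k or 2k + 1, so k is at least 4.\<close>

lemma no_large_exponent:
  fixes z :: int
  assumes m: "m \<ge> 8" and z: "z \<ge> 0"
  shows "9 * (z * z) \<noteq> 8 * 10 ^ m + 289" "9 * (z * z) \<noteq> 2 * 10 ^ m + 196" "9 * (z * z) \<noteq> 8 * 10 ^ m + 784"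
    "9 * (z * z) \<noteq> 7 * 10 ^ m + 899984" "9 * (z * z) \<noteq> 6 * 10 ^ m + 489" "9 * (z * z) \<noteq> 2 * 10 ^ m + 889"
    "9 * (z * z) \<noteq> 3 * 10 ^ m + 996" "9 * (z * z) \<noteq> 4 * 10 ^ m + 689"
proof -
  have sq: "(3 * z) * (3 * z) = 9 * (z * z)" by simp
  show "9 * (z * z) \<noteq> 8 * 10 ^ m + 289" "9 * (z * z) \<noteq> 2 * 10 ^ m + 196" "9 * (z * z) \<noteq> 8 * 10 ^ m + 784"
    using difference_of_squares_bound[of "3 * z" 8 m 17] difference_of_squares_bound[of "3 * z" 2 m 14]
      difference_of_squares_bound[of "3 * z" 8 m 28] m z unfolding sq by auto
  have lt: "m mod P < P" if "P > 0" for P using that by simp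
  have parity: "even (m mod 8) = even m" "even (m mod 30) = even m" "even (m mod 2) = even m"
    by presburger+
  have residues: "m mod 8 \<in> set (filter even [0..<8])" "m mod 2 \<in> set (filter even [0..<2])" if "even m"
    using that parity lt by auto
  have residues': "m mod 8 \<in> set (filter odd [0..<8])" "m mod 2 \<in> set (filter odd [0..<2])"
     "m mod 30 \<in> set (filter odd [0..<30])" if "odd m"
    using that parity lt by auto
  \<comment> \<open>The primes divide 10^8 - 1 (even m) or 10^30 - 1 (odd m), so powers of 10 have
    short periods.\<close>
  show "9 * (z * z) \<noteq> 7 * 10 ^ m + 899984"
  proof (cases "even m")
    case True
    show ?thesis
      by (rule obstructed_covering[where Q = "[(73, 8), (101, 4)]", OF _ _ residues(1)[OF True]])
        (code_simp, code_simp)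
  next
    case False
    show ?thesis
      by (rule obstructed_covering[where Q = "[(31, 15), (37, 3), (211, 30), (241, 30)]", OF _ _ residues'(3)[OF False]])
        (code_simp, code_simp)
  qed
  show "9 * (z * z) \<noteq> 6 * 10 ^ m + 489"
  proof (cases "even m")
    case True
    then obtain k where k: "m = k + k" by (metis evenE mult_2)
    have "3 * (z * z) \<noteq> 2 * (10 ^ k * 10 ^ k) + 163"
      using pell_163 z m k by simp
    then show ?thesis by (auto simp: k power_add)
  next
    case False
    show ?thesis
      by (rule obstructed_covering[where Q = "[(11, 2)]", OF _ _ residues'(2)[OF False]])
        (code_simp, code_simp)
  qed
  show "9 * (z * z) \<noteq> 2 * 10 ^ m + 889"
  proof (cases "even m")
    case True
    then obtain k where k: "m = k + k" by (metis evenE mult_2)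
    have "(3 * z) * (3 * z) \<noteq> 2 * (10 ^ k * 10 ^ k) + 889"
      using pell_889[of "3 * z" k] z m k by simp
    then show ?thesis by (auto simp: k power_add)
  next
    case False
    show ?thesis
      by (rule obstructed_covering[where Q = "[(11, 2)]", OF _ _ residues'(2)[OF False]])
        (code_simp, code_simp)
  qed
  show "9 * (z * z) \<noteq> 3 * 10 ^ m + 996"
  proof (cases "even m")
    case True
    then obtain k where k: "m = k + k" by (metis evenE mult_2)
    have "3 * (z * z) \<noteq> 10 ^ k * 10 ^ k + 332"
      using pell_332 z m k by simp
    then show ?thesis by (auto simp: k power_add)
  next
    case False
    show ?thesis
      by (rule obstructed_covering[where Q = "[(73, 8), (137, 8)]", OF _ _ residues'(1)[OF False]])
        (code_simp, code_simp)
  qed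
  show "9 * (z * z) \<noteq> 4 * 10 ^ m + 689"
  proof (cases "even m")
    case True
    then obtain k where k: "m = k + k" by (metis evenE mult_2)
    \<comment> \<open>For even m the term 4 * 10^m is a square Y^2, and Y^2 + 689 lies strictly
      between Y^2 and (Y + 1)^2.\<close>
    define Y :: int where "Y = 2 * 10 ^ k"
    have "k \<ge> 4" using k m by simp
    then have Y: "Y \<ge> 20000"
      unfolding Y_def using power_increasing[of 4 k "10 :: int"] by simp
    show ?thesis
    proof
      assume "9 * (z * z) = 4 * 10 ^ m + 689"
      then have eq: "(3 * z) * (3 * z) = Y * Y + 689"
        by (simp add: Y_def k power_add)
      have "Y + 1 \<le> 3 * z"
      proof (rule ccontr)
        assume "\<not> Y + 1 \<le> 3 * z"
        then have "(3 * z) * (3 * z) \<le> Y * Y" using z Y by (intro mult_mono) auto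
        then show False using eq by simp
      qed
      then have "(Y + 1) * (Y + 1) \<le> (3 * z) * (3 * z)" using Y z by (intro mult_mono) auto
      then show False using eq Y by (simp add: algebra_simps)
    qed
  next
    case False
    then obtain k where k: "m = Suc (k + k)" by (metis oddE mult_2 Suc_eq_plus1)
    have "(3 * z) * (3 * z) \<noteq> 10 * ((2 * 10 ^ k) * (2 * 10 ^ k)) + 689"
      using pell_689[of "3 * z" k] z m k by simp
    then show ?thesis by (auto simp: k power_add)
  qed
qed

section \<open>Reduction to finitely many triples\<close>

definition solution :: "nat \<Rightarrow> int \<Rightarrow> nat \<Rightarrow> int \<Rightarrow> bool" where
  "solution m a n b \<longleftrightarrow> m = 2 \<and> n = 2 \<and> a + b = 11
    \<or> (m, a, n, b) \<in> {(3, 1, 2, 3), (4, 1, 3, 3), (5, 4, 2, 7)}"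

definition candidates :: "(int \<times> int \<times> nat) list" where
  "candidates =
    [(9, 2, 2), (8, 3, 2), (7, 4, 2), (6, 5, 2), (5, 6, 2), (4, 7, 2), (3, 8, 2), (2, 9, 2),
     (3, 1, 2), (2, 2, 2), (1, 3, 2),
     (3, 1, 3), (2, 2, 3), (1, 3, 3),
     (9, 7, 2), (8, 8, 2), (7, 9, 2), (9, 7, 3), (8, 8, 3), (7, 9, 3),
     (9, 7, 4), (8, 8, 4), (7, 9, 4), (9, 7, 5), (8, 8, 5), (7, 9, 5)]"

lemma candidates_small:
  "list_all (\<lambda>(a, b, n). list_all (\<lambda>m. if solution m a n b then True
      else list_ex (\<lambda>q. obstructed q (a * 10 ^ m + b * 10 ^ n - (a + b))) [7, 13, 17, 19, 53]) [n..<8]) candidates"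
  by code_simp

text \<open>Once m is at least 8, a 10^m vanishes modulo 256 = 2^8 and only the constant term
  matters.\<close>

lemma candidates_large:
  "list_all (\<lambda>(a, b, n). if List.member [(8,3,2),(2,2,2),(8,8,2),(7,9,5),(6,5,2),(2,9,2),(3,1,3),(4,7,2)] (a, b, n) then True
      else obstructed 256 (b * 10 ^ n - (a + b))) candidates"
  by code_simp

lemma digit_sum:
  "list_all (\<lambda>c. if List.member [4, 11, 16] c then True else obstructed 100 (- c)) [2..18]"
  by code_simp

text \<open>-11 is 5 modulo 8, while -4 and -16 are -1 times an even power of 2, and -1 is not a
  square modulo 4.\<close>

lemma small_obstructions: "obstructed 8 (- 11)" "obstructed 16 (- 4)" "obstructed 64 (- 16)"
  by code_simp+

lemma candidate_of_square:
  fixes a b z :: int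
  assumes "1 \<le> a" "a \<le> 9" "1 \<le> b" "b \<le> 9" "2 \<le> n" "n \<le> m"
    and eq: "9 * (z * z) = a * 10 ^ m + b * 10 ^ n - (a + b)"
  shows "(a, b, n) \<in> set candidates"
proof -
  have dvd: "q dvd a * 10 ^ m + b * 10 ^ n - (a + b) - (- (a + b))" if "q dvd 10 ^ j" "j \<le> n" for q j
    using dvd_ten_power[OF that(1)] that(2) assms(6) by simp
  have no: "\<not> obstructed q (- (a + b))" if "q dvd 10 ^ j" "j \<le> n" for q j
    using obstructedD[OF _ dvd[OF that]] eq by blast
  have "\<not> obstructed 100 (- (a + b))" using no[of 100 2] assms(5) by simp
  moreover have "a + b \<in> set [2..18]" using assms(1-4) unfolding set_upto by simp
  ultimately have "List.member [4, 11, 16] (a + b)"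
    using digit_sum unfolding list_all_iff by metis
  then have c: "a + b \<in> {4, 11, 16}" by simp
  have "n < 3" if "a + b = 11" using small_obstructions no[of 8 3] that by fastforce
  moreover have "n < 4" if "a + b = 4" using small_obstructions no[of 16 4] that by fastforce
  moreover have "n < 6" if "a + b = 16" using small_obstructions no[of 64 6] that by fastforce
  ultimately consider "a + b = 11" "n = 2" | "a + b = 4" "n = 2 \<or> n = 3"
    | "a + b = 16" "n = 2 \<or> n = 3 \<or> n = 4 \<or> n = 5"
    using c assms(5) by force
  then show ?thesis
  proof cases
    case 1
    then have "a = 11 - b" "b = 2 \<or> b = 3 \<or> b = 4 \<or> b = 5 \<or> b = 6 \<or> b = 7 \<or> b = 8 \<or> b = 9"
      using assms(1-4) by presburger+
    with 1(2) show ?thesis by (elim disjE) (simp_all add: candidates_def)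
  next
    case 2
    then have "a = 4 - b" "b = 1 \<or> b = 2 \<or> b = 3"
      using assms(1-4) by presburger+
    with 2(2) show ?thesis by (elim disjE) (simp_all add: candidates_def)
  next
    case 3
    then have "a = 16 - b" "b = 7 \<or> b = 8 \<or> b = 9"
      using assms(1-4) by presburger+
    with 3(2) show ?thesis by (elim disjE) (simp_all add: candidates_def)
  qed
qed

lemma exponent_equation:
  fixes a b z :: int
  assumes "1 \<le> a" "a \<le> 9" "1 \<le> b" "b \<le> 9" "2 \<le> n" "n \<le> m" "0 \<le> z"
    and eq: "9 * (z * z) = a * 10 ^ m + b * 10 ^ n - (a + b)"
  shows "solution m a n b"
proof -
  have cand: "(a, b, n) \<in> set candidates"
    using candidate_of_square[OF assms(1-6) eq] .
  show ?thesis
  proof (cases "m < 8")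
    case True
    show ?thesis
    proof (rule ccontr)
      assume nsol: "\<not> solution m a n b"
      have "m \<in> set [n..<8]" using True assms(6) by simp
      then have "list_ex (\<lambda>q. obstructed q (a * 10 ^ m + b * 10 ^ n - (a + b))) [7, 13, 17, 19, 53]"
        using bspec[OF candidates_small[unfolded list_all_iff] cand] nsol
        unfolding prod.case by metis
      then obtain q where "obstructed q (a * 10 ^ m + b * 10 ^ n - (a + b))"
        unfolding list_ex_iff by blast
      then show False using obstructedD[of q "a * 10 ^ m + b * 10 ^ n - (a + b)" "a * 10 ^ m + b * 10 ^ n - (a + b)" z] eq by simp
    qed
  next
    case False
    then have m: "m \<ge> 8" by simp
    have "256 dvd a * 10 ^ m" using dvd_ten_power[of 256 8 m a] m by simp
    then have "\<not> obstructed 256 (b * 10 ^ n - (a + b))"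
      using obstructedD[of 256 "b * 10 ^ n - (a + b)" "a * 10 ^ m + b * 10 ^ n - (a + b)" z] eq
      by (auto simp: algebra_simps)
    then have "(a, b, n) \<in> {(8,3,2),(2,2,2),(8,8,2),(7,9,5),(6,5,2),(2,9,2),(3,1,3),(4,7,2)}"
      using bspec[OF candidates_large[unfolded list_all_iff] cand] by (auto split: if_splits)
    then show ?thesis
      using no_large_exponent[OF m assms(7)] eq by auto
  qed
qed

subsection \<open>Repdigits\<close>

text \<open>Dropping the last digit preserves the digit condition and divides 9n + d by 10. The form
  of the equation avoids division and subtraction in \<open>nat\<close>.\<close>

lemma constant_digits:
  fixes n d :: nat
  assumes "\<forall>i. 10 ^ i \<le> n \<longrightarrow> n div 10 ^ i mod 10 = d" "n > 0"
  shows "1 \<le> d \<and> d \<le> 9 \<and> (\<exists>m\<ge>1. 9 * n + d = d * 10 ^ m)"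
  using assms
proof (induction n rule: less_induct)
  case (less n)
  have d: "n mod 10 = d" using less.prems(1)[rule_format, of 0] less.prems(2) by simp
  show ?case
  proof (cases "n < 10")
    case True
    then have "n = d" using d by simp
    then show ?thesis using True less.prems(2) by (intro conjI exI[of _ 1]) auto
  next
    case False
    have "n div 10 div 10 ^ i mod 10 = d" if "10 ^ i \<le> n div 10" for i
    proof -
      have "10 ^ Suc i \<le> n" using that by (simp add: less_eq_div_iff_mult_less_eq mult.commute)
      then show ?thesis using less.prems(1)[rule_format, of "Suc i"] by (simp add: div_mult2_eq)
    qed
    then obtain m where m: "1 \<le> d" "d \<le> 9" "m \<ge> 1" "9 * (n div 10) + d = d * 10 ^ m"
      using less.IH[of "n div 10"] False by (auto simp: div_greater_zero_iff)
    have "9 * n + d = 10 * (9 * (n div 10) + d)"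
      using mult_div_mod_eq[of 10 n] unfolding d by simp
    then have "9 * n + d = d * 10 ^ Suc m" using m(4) by simp
    then show ?thesis using m by (intro conjI exI[of _ "Suc m"]) auto
  qed
qed

lemma repdigitE:
  assumes "repdigit x"
  obtains d m where "1 \<le> d" "d \<le> 9" "2 \<le> m" "9 * x + d = d * 10 ^ m"
proof -
  obtain d where "\<forall>i. 10 ^ i \<le> x \<longrightarrow> x div 10 ^ i mod 10 = d" and x: "x > 10"
    using assms unfolding repdigit_def by blast
  then obtain m where m: "1 \<le> d" "d \<le> 9" "m \<ge> 1" "9 * x + d = d * 10 ^ m"
    using constant_digits[of x d] by auto
  moreover have "m \<noteq> 1" using m x by auto
  ultimately show thesis using that[of d m] by simp
qed

text \<open>Only positions below \<open>k\<close> occur in \<open>x\<close>, so the quantifier over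
  positions becomes a finite check.\<close>

lemma repdigitI:
  assumes "x > 10" "x < 10 ^ k" "list_all (\<lambda>i. 10 ^ i \<le> x \<longrightarrow> x div 10 ^ i mod 10 = x mod 10) [0..<k]"
  shows "repdigit x"
proof -
  have "i < k" if "10 ^ i \<le> x" for i
    using order.strict_trans1[OF that assms(2)] by simp
  then show ?thesis using assms(1,3) unfolding repdigit_def list_all_iff by (metis atLeast_upt lessThan_iff)
qed

section \<open>The list of pairs and the classification\<close>

definition square_sums :: "(nat \<times> nat) set" where
  "square_sums = {(99, 22), (88, 33), (77, 44), (66, 55), (111, 33), (1111, 333), (44444, 77)}"

lemma square_sums_repdigit:
  assumes "(x, y) \<in> square_sums"
  shows "repdigit x" "repdigit y"
proof -
  have upt: "[0..<5] = [0, 1, 2, 3, 4 :: nat]" by (simp add: upt_rec)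
  have "repdigit 99" "repdigit 88" "repdigit 77" "repdigit 66" "repdigit 55" "repdigit 44" "repdigit 33"
    "repdigit 22" "repdigit 111" "repdigit 333" "repdigit 1111" "repdigit 44444"
    by (rule repdigitI[where k = 5]; simp add: upt)+
  then show "repdigit x" "repdigit y"
    using assms unfolding square_sums_def by auto
qed

text \<open>The swapped pair arises when m = n = 2 and a < b.\<close>

lemma solution_square_sums:
  assumes "solution m (int a) n (int b)" "9 * x + a = a * 10 ^ m" "9 * y + b = b * 10 ^ n"
    "1 \<le> a" "a \<le> 9" "1 \<le> b" "b \<le> 9"
  shows "(x, y) \<in> square_sums \<or> (y, x) \<in> square_sums"
proof (cases "m = 2 \<and> n = 2 \<and> a + b = 11")
  case True
  then have "b = 11 - a" "x = 11 * a" "y = 11 * b" using assms by auto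
  moreover have "a = 2 \<or> a = 3 \<or> a = 4 \<or> a = 5 \<or> a = 6 \<or> a = 7 \<or> a = 8 \<or> a = 9"
    using True assms(5,7) by presburger
  ultimately show ?thesis by (elim disjE) (simp_all add: square_sums_def)
next
  case False
  then consider "m = 3" "a = 1" "n = 2" "b = 3" | "m = 4" "a = 1" "n = 3" "b = 3" | "m = 5" "a = 4" "n = 2" "b = 7"
    using assms(1) unfolding solution_def by auto
  then have "x = 111 \<and> y = 33 \<or> x = 1111 \<and> y = 333 \<or> x = 44444 \<and> y = 77"
    using assms(2,3) by cases simp_all
  then show ?thesis by (elim disjE conjE) (simp_all add: square_sums_def)
qed

lemma square_repdigit_sum:
  assumes "repdigit x" "repdigit y" "is_square (x + y)" "y \<le> x"
  shows "(x, y) \<in> square_sums"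
proof -
  obtain a m where a: "1 \<le> a" "a \<le> 9" "2 \<le> m" "9 * x + a = a * 10 ^ m"
    using repdigitE[OF assms(1)] .
  obtain b n where b: "1 \<le> b" "b \<le> 9" "2 \<le> n" "9 * y + b = b * 10 ^ n"
    using repdigitE[OF assms(2)] .
  obtain z where z: "x + y = z * z"
    using assms(3) by (auto simp: is_nth_power_def power2_eq_square)
  have "int (9 * (z * z) + (a + b)) = int (a * 10 ^ m + b * 10 ^ n)"
    using a(4) b(4) z by (intro arg_cong[where f = int]) linarith
  then have eq: "9 * (int z * int z) = int a * 10 ^ m + int b * 10 ^ n - (int a + int b)"
    by simp
  \<comment> \<open>\<open>exponent_equation\<close> expects the larger exponent first, so the
    summands may have to trade places.\<close>
  have "(x, y) \<in> square_sums \<or> (y, x) \<in> square_sums"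
  proof (cases "n \<le> m")
    case True
    then have "solution m (int a) n (int b)"
      using a b eq by (intro exponent_equation[where z = "int z"]) auto
    then show ?thesis using solution_square_sums a b by blast
  next
    case False
    then have "solution n (int b) m (int a)"
      using a b eq by (intro exponent_equation[where z = "int z"]) auto
    then show ?thesis using solution_square_sums a b by blast
  qed
  \<comment> \<open>Each listed pair is strictly decreasing, so y \<le> x excludes the swapped
    one.\<close>
  then show ?thesis using assms(4) by (auto simp: square_sums_def)
qed

lemma repdigit_sums_square:
  "repdigit_sums (r\<^sup>2) = {(x, y) \<in> square_sums. x + y = r\<^sup>2}"
proof (intro set_eqI iffI)
  fix p assume "p \<in> repdigit_sums (r\<^sup>2)"
  then obtain x y where p: "p = (x, y)" and xy: "repdigit x" "repdigit y" "y \<le> x" "r\<^sup>2 = x + y"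
    unfolding repdigit_sums_def by blast
  moreover have "is_square (x + y)" unfolding xy(4)[symmetric] by simp
  ultimately have "(x, y) \<in> square_sums" using square_repdigit_sum by blast
  then show "p \<in> {(x, y) \<in> square_sums. x + y = r\<^sup>2}" using p xy by simp
next
  fix p assume "p \<in> {(x, y) \<in> square_sums. x + y = r\<^sup>2}"
  then obtain x y where p: "p = (x, y)" and xy: "(x, y) \<in> square_sums" "r\<^sup>2 = x + y" by auto
  have "y \<le> x" using xy(1) by (auto simp: square_sums_def)
  then show "p \<in> repdigit_sums (r\<^sup>2)"
    using square_sums_repdigit[OF xy(1)] xy(2) p unfolding repdigit_sums_def by blast
qed

theorem theorem1:
  shows "{s :: nat. is_square s \<and> (\<exists>x y. repdigit x \<and> repdigit y \<and> s = x + y)}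
           = {11\<^sup>2, 12\<^sup>2, 38\<^sup>2, 211\<^sup>2}
       \<and> repdigit_sums (11\<^sup>2) = {(99, 22), (88, 33), (77, 44), (66, 55)}
       \<and> repdigit_sums (12\<^sup>2) = {(111, 33)}
       \<and> repdigit_sums (38\<^sup>2) = {(1111, 333)}
       \<and> repdigit_sums (211\<^sup>2) = {(44444, 77)}"
proof (intro conjI)
  show "{s :: nat. is_square s \<and> (\<exists>x y. repdigit x \<and> repdigit y \<and> s = x + y)}
           = {11\<^sup>2, 12\<^sup>2, 38\<^sup>2, 211\<^sup>2}" (is "?A = ?B")
  proof
    show "?A \<subseteq> ?B"
    proof
      fix s assume "s \<in> ?A"
      then obtain x y where "is_square (x + y)" "repdigit x" "repdigit y" and s: "s = x + y" by blast
      then have "(x, y) \<in> square_sums \<or> (y, x) \<in> square_sums"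
        using square_repdigit_sum[of x y] square_repdigit_sum[of y x]
        by (metis add.commute nat_le_linear)
      then show "s \<in> ?B" using s by (auto simp: square_sums_def)
    qed
    have "r\<^sup>2 \<in> ?A" if "(x, y) \<in> square_sums" "x + y = r\<^sup>2" for x y r
      using that square_sums_repdigit[OF that(1)] is_nth_power_nth_power[of 2 r] by force
    from this[of 99 22 11] this[of 111 33 12] this[of 1111 333 38] this[of 44444 77 211]
    show "?B \<subseteq> ?A" by (simp add: square_sums_def)
  qed
qed (unfold repdigit_sums_square square_sums_def, auto)

end
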